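(* Let $G$ be a cycle of length $L>0$, regarded as a metric graph, and let $w\ge 0$ be an integer. For every graph $G_w$ obtained from $G$ by adding $w$ wormholes, $\mathrm{diam}(G_w)\ge L/(w+2)$. Moreover, if $w$ is even, then there is a choice of $w$ wormholes for which $\mathrm{diam}(G_w)=L/(w+2)$.
   Context: A metric graph is a finite edge-weighted graph regarded as a metric space in which all points in the interior of each edge are included and each edge is locally isometric to an interval whose length is the edge weight; $\mathrm{diam}(G)=\max_{x,y\in G} d_G(x,y)$ over all points of $G$, where $d_G(x,y)$ is the minimum length of a path from $x$ to $y$. A wormhole is a pair of points of $G$ (arbitrary points, not necessarily vertices); adding a wormhole means identifying its two points, equivalently adding an edge of length zero between them. $G_w$ is the metric graph obtained after all the identifications. Different wormholes may share points. *)

theory Defs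
  imports Complex_Main
begin

text \<open>
  A finite edge-weighted multigraph (loops and parallel edges allowed). The graph is undirected:
  \<open>tail\<close> and \<open>head\<close> only fix in which direction an edge is parametrised by
  the interval from 0 to its length.
\<close>

record ('v, 'e) weighted_graph =
  verts :: "'v set"
  edges :: "'e set"
  tail :: "'e \<Rightarrow> 'v"
  head :: "'e \<Rightarrow> 'v"
  len :: "'e \<Rightarrow> real"

definition wf_graph :: "('v, 'e) weighted_graph \<Rightarrow> bool" where
  "wf_graph G \<longleftrightarrow> finite (verts G) \<and> finite (edges G) \<and>
     (\<forall>e\<in>edges G. tail G e \<in> verts G \<and> head G e \<in> verts G \<and> len G e > 0)"

definition total_length :: "('v, 'e) weighted_graph \<Rightarrow> real" where
  "total_length G = (\<Sum>e\<in>edges G. len G e)"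

text \<open>
  For \<open>n = 1\<close> this is a single loop and for \<open>n = 2\<close> a pair of parallel edges; both are
  cycles when regarded as metric graphs.
\<close>

definition is_cycle :: "('v, 'e) weighted_graph \<Rightarrow> bool" where
  "is_cycle G \<longleftrightarrow> wf_graph G \<and>
     (\<exists>n v e. n \<ge> (1::nat) \<and> bij_betw v {..<n} (verts G) \<and> bij_betw e {..<n} (edges G) \<and>
        (\<forall>i<n. {tail G (e i), head G (e i)} = {v i, v (Suc i mod n)}))"

datatype ('v, 'e) point = Vertex 'v | Interior 'e real

definition points :: "('v, 'e) weighted_graph \<Rightarrow> ('v, 'e) point set" where
  "points G = Vertex ` verts G \<union> {Interior e t | e t. e \<in> edges G \<and> 0 < t \<and> t < len G e}"

definition edge_point :: "('v, 'e) weighted_graph \<Rightarrow> 'e \<Rightarrow> real \<Rightarrow> ('v, 'e) point" where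
  "edge_point G e t =
     (if t = 0 then Vertex (tail G e)
      else if t = len G e then Vertex (head G e)
      else Interior e t)"

text \<open>
  Wormholes are given as a list of pairs of points, so that a choice of \<open>w\<close> wormholes is a list
  of length \<open>w\<close>. The metric graph with the wormholes added has as its points the classes of the
  equivalence relation generated by the list; the empty list gives the metric graph itself.
\<close>

type_synonym ('v, 'e) wormhole = "('v, 'e) point \<times> ('v, 'e) point"

definition identified ::
  "('v, 'e) weighted_graph \<Rightarrow> ('v, 'e) wormhole list \<Rightarrow> (('v, 'e) point \<times> ('v, 'e) point) set" where
  "identified G ws = (set ws \<union> (set ws)\<inverse>)\<^sup>* \<inter> (points G \<times> points G)"

definition wpoints ::
  "('v, 'e) weighted_graph \<Rightarrow> ('v, 'e) wormhole list \<Rightarrow> ('v, 'e) point set set" where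
  "wpoints G ws = points G // identified G ws"

text \<open>
  \<open>wpath G ws x y l\<close>: there is a path of length \<open>l\<close> from \<open>x\<close> to \<open>y\<close>, made up of finitely many
  moves, each along a segment of one closed edge. A move may start at any representative of the
  class where the previous one ended, which is how a path goes through wormholes.
\<close>

inductive wpath ::
  "('v, 'e) weighted_graph \<Rightarrow> ('v, 'e) wormhole list \<Rightarrow>
     ('v, 'e) point set \<Rightarrow> ('v, 'e) point set \<Rightarrow> real \<Rightarrow> bool"
  for G ws where
  stay: "x \<in> wpoints G ws \<Longrightarrow> wpath G ws x x 0"
| move: "wpath G ws x (identified G ws `` {edge_point G e s}) l \<Longrightarrow>
    e \<in> edges G \<Longrightarrow> s \<in> {0..len G e} \<Longrightarrow> t \<in> {0..len G e} \<Longrightarrow>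
    wpath G ws x (identified G ws `` {edge_point G e t}) (l + \<bar>s - t\<bar>)"

definition wdist ::
  "('v, 'e) weighted_graph \<Rightarrow> ('v, 'e) wormhole list \<Rightarrow>
     ('v, 'e) point set \<Rightarrow> ('v, 'e) point set \<Rightarrow> real" where
  "wdist G ws x y = Inf {l. wpath G ws x y l}"

definition wdiam :: "('v, 'e) weighted_graph \<Rightarrow> ('v, 'e) wormhole list \<Rightarrow> real" where
  "wdiam G ws = Sup {wdist G ws x y | x y. x \<in> wpoints G ws \<and> y \<in> wpoints G ws}"

end

theory Submission
  imports Defs
begin

text \<open>
  Cut the circle into \<open>w + 2\<close> arcs of length \<open>D = L / (w + 2)\<close> and even glue all the cut points
  together; some two arc midpoints are still at distance at least \<open>D\<close>. An arc whose midpoint is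
  closer than \<open>D / 2\<close> to the cut points is left by its shortest path through a wormhole, and
  different arcs are left through different wormholes, because a shortest path tree uses each
  wormhole in one direction only. Hence some midpoint \<open>m\<close> is at distance at least \<open>D / 2\<close> from
  the cut points. If all other midpoints were closer than \<open>D\<close> to \<open>m\<close>, their shortest paths to \<open>m\<close>
  would also leave their arcs through wormholes, which gives \<open>w + 1\<close> distinct wormholes.

  For even \<open>w\<close> the bound is attained by identifying alternate cut points, which yields two
  vertices joined by \<open>w + 2\<close> edges of length \<open>D\<close>.
\<close>

section \<open>Distance to the grid of cut points\<close>

text \<open>For \<open>D > 0\<close>, the distance from \<open>x\<close> to the nearest multiple of
  \<open>D\<close>: what it costs to reach the glued cut point from \<open>x\<close>.\<close>

definition grid_dist :: "real \<Rightarrow> real \<Rightarrow> real" where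
  "grid_dist D x = min (x - D * \<lfloor>x / D\<rfloor>) (D * (\<lfloor>x / D\<rfloor> + 1) - x)"

lemma grid_dist_nonneg:
  assumes "D > 0"
  shows "grid_dist D x \<ge> 0"
proof -
  have "\<lfloor>x / D\<rfloor> \<le> x / D" "x / D < \<lfloor>x / D\<rfloor> + 1" by linarith+
  then have "D * \<lfloor>x / D\<rfloor> \<le> D * (x / D)" "D * (x / D) < D * (\<lfloor>x / D\<rfloor> + 1)"
    using assms by (intro mult_left_mono mult_strict_left_mono; simp)+
  then show ?thesis using assms unfolding grid_dist_def by simp
qed

lemma grid_dist_multiple: "D > 0 \<Longrightarrow> grid_dist D (real k * D) = 0"
  by (simp add: grid_dist_def min_def)

lemma grid_dist_same_cell:
  assumes "\<lfloor>x / D\<rfloor> = \<lfloor>y / D\<rfloor>"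
  shows "grid_dist D x \<le> grid_dist D y + \<bar>x - y\<bar>"
  using assms unfolding grid_dist_def by (auto simp: min_def abs_if)

text \<open>The segment between the points leaves the lower one's cell at its upper end and enters
  the other cell at its lower end; these two pieces are disjoint and each is at least the respective
  grid distance.\<close>

lemma grid_dist_different_cells:
  assumes "D > 0" and "\<lfloor>x / D\<rfloor> \<noteq> \<lfloor>y / D\<rfloor>"
  shows "grid_dist D x + grid_dist D y \<le> \<bar>x - y\<bar>"
proof -
  have *: "grid_dist D x + grid_dist D y \<le> y - x" if "\<lfloor>x / D\<rfloor> < \<lfloor>y / D\<rfloor>" for x y
  proof -
    have "real_of_int \<lfloor>x / D\<rfloor> + 1 \<le> \<lfloor>y / D\<rfloor>" using that by linarith
    then have "D * (real_of_int \<lfloor>x / D\<rfloor> + 1) \<le> D * \<lfloor>y / D\<rfloor>"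
      using assms(1) by (intro mult_left_mono) auto
    then show ?thesis unfolding grid_dist_def by (auto simp: min_def)
  qed
  show ?thesis using *[of x y] *[of y x] assms(2) by linarith
qed

lemma midpoint_cell:
  assumes "D > 0"
  shows "\<lfloor>(real i + 1/2) * D / D\<rfloor> = int i" and "grid_dist D ((real i + 1/2) * D) = D / 2"
proof -
  show *: "\<lfloor>(real i + 1/2) * D / D\<rfloor> = int i" using assms by (simp add: floor_eq_iff)
  show "grid_dist D ((real i + 1/2) * D) = D / 2"
    unfolding grid_dist_def * by (simp add: algebra_simps min_def)
qed

section \<open>Paths on the bouquet of arcs\<close>

text \<open>
  \<open>bouquet_path D W t x l N\<close>: a path of length \<open>l\<close> with \<open>N\<close> jumps joins \<open>t\<close> to \<open>x\<close> on the line
  whose points \<open>k * D\<close> have all been glued together.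
\<close>

inductive bouquet_path ::
  "real \<Rightarrow> (real \<times> real) set \<Rightarrow> real \<Rightarrow> real \<Rightarrow> real \<Rightarrow> nat \<Rightarrow> bool"
  for D W t where
  start: "bouquet_path D W t t 0 0"
| within: "bouquet_path D W t y l N \<Longrightarrow> \<lfloor>x / D\<rfloor> = \<lfloor>y / D\<rfloor> \<Longrightarrow>
    bouquet_path D W t x (l + \<bar>x - y\<bar>) N"
| across: "bouquet_path D W t y l N \<Longrightarrow>
    bouquet_path D W t x (l + (grid_dist D x + grid_dist D y)) N"
| jump: "bouquet_path D W t y l N \<Longrightarrow> (x, y) \<in> W \<Longrightarrow> bouquet_path D W t x l (Suc N)"

lemma bouquet_path_nonneg:
  assumes "bouquet_path D W t x l N" and "D > 0"
  shows "l \<ge> 0"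
  using assms
  by (induction rule: bouquet_path.induct) (auto intro: add_nonneg_nonneg grid_dist_nonneg)

lemma bouquet_path_trans:
  assumes "bouquet_path D W u y l N" and "bouquet_path D W t u l' N'"
  shows "bouquet_path D W t y (l' + l) (N' + N)"
  using assms
proof (induction rule: bouquet_path.induct)
  case start
  then show ?case by simp
next
  case (within y l N x)
  then show ?case using bouquet_path.within[of D W t y "l' + l" "N' + N" x] by (simp add: add.assoc)
next
  case (across y l N x)
  then show ?case using bouquet_path.across[of D W t y "l' + l" "N' + N" x] by (simp add: add.assoc)
next
  case (jump y l N x)
  then show ?case using bouquet_path.jump[of D W t y "l' + l" "N' + N" x] by simp
qed

lemma bouquet_path_sym:
  assumes "bouquet_path D W t x l N" and "sym W"
  shows "bouquet_path D W x t l N"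
  using assms
proof (induction rule: bouquet_path.induct)
  case start
  show ?case by (rule bouquet_path.start)
next
  case (within y l N x)
  have "bouquet_path D W x y (0 + \<bar>y - x\<bar>) 0"
    using within by (intro bouquet_path.within bouquet_path.start) auto
  from bouquet_path_trans[OF within.IH[OF within.prems] this]
  show ?case by (simp add: abs_minus_commute add.commute)
next
  case (across y l N x)
  have "bouquet_path D W x y (0 + (grid_dist D y + grid_dist D x)) 0"
    by (intro bouquet_path.across bouquet_path.start)
  from bouquet_path_trans[OF across.IH[OF across.prems] this]
  show ?case by (simp add: add_ac)
next
  case (jump y l N x)
  have "bouquet_path D W x y 0 (Suc 0)"
    using jump by (intro bouquet_path.jump[OF bouquet_path.start]) (auto dest: symD)
  from bouquet_path_trans[OF jump.IH[OF jump.prems] this]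
  show ?case by simp
qed

text \<open>Follow the path back from \<open>x\<close> while it stays in arc \<open>j\<close>. If it
  came through the cut points, \<open>lower\<close> at the point before \<open>across\<close> yields
  the first alternative; if it started in the arc, \<open>base\<close> does. Otherwise a jump led to
  some \<open>a\<close> in the arc, and walking straight from \<open>a\<close> to \<open>x\<close>
  is no longer than what the path did. \<open>K\<close> plays the role of a lower bound for the
  distance from \<open>t\<close> to the cut points.\<close>

lemma bouquet_path_first_jump:
  assumes "bouquet_path D W t x l N" and D: "D > 0" and eps: "\<epsilon> \<ge> 0"
    and lower: "\<And>y l N. bouquet_path D W t y l N \<Longrightarrow> l \<ge> K - grid_dist D y"
    and base: "\<lfloor>t / D\<rfloor> = j \<Longrightarrow> grid_dist D t + K \<le> 0"
    and "\<lfloor>x / D\<rfloor> = j"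
  shows "l \<ge> K + grid_dist D x \<or>
    (\<exists>a b l' N'. (a, b) \<in> W \<and> \<lfloor>a / D\<rfloor> = j \<and> bouquet_path D W t b l' N' \<and>
       \<bar>x - a\<bar> + \<epsilon> + (l' + \<epsilon> * real N') \<le> l + \<epsilon> * real N)"
  using assms(1,6)
proof (induction rule: bouquet_path.induct)
  case start
  then show ?case using base by auto
next
  case (within y l N x)
  then consider "l \<ge> K + grid_dist D y" | a b l' N' where "(a, b) \<in> W" "\<lfloor>a / D\<rfloor> = j"
       "bouquet_path D W t b l' N'" "\<bar>y - a\<bar> + \<epsilon> + (l' + \<epsilon> * real N') \<le> l + \<epsilon> * real N"
    by auto
  then show ?case
  proof cases
    case 1
    then show ?thesis using grid_dist_same_cell[of x D y] within by linarith
  next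
    case 2
    then have "\<bar>x - a\<bar> + \<epsilon> + (l' + \<epsilon> * real N') \<le> l + \<bar>x - y\<bar> + \<epsilon> * real N" by linarith
    then show ?thesis using 2 by blast
  qed
next
  case (across y l N x)
  then show ?case using lower[of y l N] by linarith
next
  case (jump y l N x)
  have "\<bar>x - x\<bar> + \<epsilon> + (l + \<epsilon> * real N) \<le> l + \<epsilon> * real (Suc N)"
    by (simp add: algebra_simps)
  then show ?case using jump by blast
qed

section \<open>Counting arcs against wormholes\<close>

text \<open>Lets each jump be charged a small price without losing strict bounds: each left side
  tends to \<open>l j\<close> as \<epsilon> decreases to 0, and \<open>J\<close> is finite.\<close>

lemma uniform_perturbation:
  fixes l c :: "'a \<Rightarrow> real"
  assumes "finite J" and "\<And>j. j \<in> J \<Longrightarrow> l j < b"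
  obtains \<epsilon> where "\<epsilon> > 0" and "\<And>j. j \<in> J \<Longrightarrow> l j + \<epsilon> * c j < b"
proof -
  have "\<forall>\<^sub>F \<epsilon> in at_right 0. l j + \<epsilon> * c j < b" if "j \<in> J" for j
  proof (rule order_tendstoD(2))
    show "((\<lambda>\<epsilon>. l j + \<epsilon> * c j) \<longlongrightarrow> l j + 0 * c j) (at_right 0)" by (intro tendsto_intros)
    show "l j + 0 * c j < b" using assms(2) that by simp
  qed
  then have "\<forall>\<^sub>F \<epsilon> in at_right 0. \<forall>j\<in>J. l j + \<epsilon> * c j < b"
    using assms(1) by (simp add: eventually_ball_finite)
  then have "\<forall>\<^sub>F \<epsilon> in at_right 0. \<epsilon> > 0 \<and> (\<forall>j\<in>J. l j + \<epsilon> * c j < b)"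
    using eventually_at_right_less by (rule eventually_conj[rotated])
  then obtain \<epsilon> where "\<epsilon> > 0 \<and> (\<forall>j\<in>J. l j + \<epsilon> * c j < b)"
    using eventually_happens trivial_limit_at_right_real by blast
  then show ?thesis using that by blast
qed

text \<open>
  Every arc of \<open>J\<close> whose midpoint is too close to \<open>t\<close> is left by a jump. A jump costs \<open>\<epsilon>\<close>, so
  almost shortest paths to \<open>t\<close> use each wormhole in one direction only, and the first jumps
  of different arcs belong to different wormholes.
\<close>

lemma card_arcs_le_wormholes:
  assumes D: "D > 0" and "finite J" and "finite P"
    and near: "\<And>j. j \<in> J \<Longrightarrow>
      \<exists>l N. bouquet_path D (P \<union> P\<inverse>) t ((real j + 1/2) * D) l N \<and> l < K + D / 2"
    and lower: "\<And>y l N. bouquet_path D (P \<union> P\<inverse>) t y l N \<Longrightarrow> l \<ge> K - grid_dist D y"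
    and base: "\<And>j. j \<in> J \<Longrightarrow> \<lfloor>t / D\<rfloor> = int j \<Longrightarrow> grid_dist D t + K \<le> 0"
  shows "card J \<le> card P"
proof -
  define W where "W = P \<union> P\<inverse>"
  define m where "m j = (real j + 1/2) * D" for j :: nat
  obtain l0 N0 where l0: "bouquet_path D W t (m j) (l0 j) (N0 j)" "l0 j < K + D / 2" if "j \<in> J" for j
    using near[folded W_def, folded m_def] by metis
  obtain \<epsilon> where eps: "\<epsilon> > 0" "\<And>j. j \<in> J \<Longrightarrow> l0 j + \<epsilon> * real (N0 j) < K + D / 2"
    using uniform_perturbation[OF \<open>finite J\<close>, of l0 "K + D / 2" "\<lambda>j. real (N0 j)"] l0(2) by blast
  \<comment> \<open>\<open>h x\<close> is the distance from \<open>t\<close> to \<open>x\<close>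
    when every jump costs an extra \<epsilon>. An infimum is taken, so minimal paths need not
    exist.\<close>
  define C where "C x = {l + \<epsilon> * real N | l N. bouquet_path D W t x l N}" for x
  define h where "h x = Inf (C x)" for x
  have bdd: "bdd_below (C x)" for x
    unfolding C_def by (rule bdd_belowI[of _ 0]) (use bouquet_path_nonneg[OF _ D] eps(1) in auto)
  have h_le: "h x \<le> l + \<epsilon> * real N" if "bouquet_path D W t x l N" for x l N
    unfolding h_def using that bdd by (intro cInf_lower) (auto simp: C_def)
  have "\<exists>a b. (a, b) \<in> W \<and> \<lfloor>a / D\<rfloor> = int j \<and> h b < h a" if j: "j \<in> J" for j
  proof -
    \<comment> \<open>The path is chosen within less than \<epsilon> of the infimum, so that the
      price of a single jump outweighs the error.\<close>
    have "h (m j) < min (h (m j) + \<epsilon>) (K + D / 2)"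
      using eps(1) eps(2)[OF j] h_le[OF l0(1)[OF j]] by simp
    moreover have "C (m j) \<noteq> {}" unfolding C_def using l0(1)[OF j] by blast
    ultimately obtain c where "c \<in> C (m j)" "c < min (h (m j) + \<epsilon>) (K + D / 2)"
      using cInf_lessD[of "C (m j)"] unfolding h_def by blast
    then obtain l N where lN: "bouquet_path D W t (m j) l N"
      "l + \<epsilon> * real N < h (m j) + \<epsilon>" "l + \<epsilon> * real N < K + D / 2"
      unfolding C_def by auto
    have "\<epsilon> * real N \<ge> 0" using eps(1) by simp
    \<comment> \<open>Midpoints have grid distance \<open>D / 2\<close>, so the path is too short to
      have come through the cut points; it must have jumped into the arc.\<close>
    then have "\<not> l \<ge> K + grid_dist D (m j)"
      using lN(3) midpoint_cell(2)[OF D, of j] unfolding m_def by linarith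
    moreover have "l \<ge> K + grid_dist D (m j) \<or>
      (\<exists>a b l' N'. (a, b) \<in> W \<and> \<lfloor>a / D\<rfloor> = int j \<and> bouquet_path D W t b l' N' \<and>
         \<bar>m j - a\<bar> + \<epsilon> + (l' + \<epsilon> * real N') \<le> l + \<epsilon> * real N)"
    proof (rule bouquet_path_first_jump[OF lN(1) D less_imp_le[OF eps(1)]])
      show "l \<ge> K - grid_dist D y" if "bouquet_path D W t y l N" for y l N
        using that unfolding W_def by (rule lower)
      show "\<lfloor>m j / D\<rfloor> = int j" unfolding m_def by (rule midpoint_cell(1)[OF D])
    qed (rule base[OF j])
    ultimately obtain a b l' N' where ab: "(a, b) \<in> W" "\<lfloor>a / D\<rfloor> = int j"
      "bouquet_path D W t b l' N'"
      "\<bar>m j - a\<bar> + \<epsilon> + (l' + \<epsilon> * real N') \<le> l + \<epsilon> * real N"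
      by blast
    \<comment> \<open>Walking inside the arc raises \<open>h\<close> by at most the distance walked.
      With the jump inequality, \<open>h b + |m j - a| < h (m j) \<le> h a + |m j - a|\<close>, so
      \<open>h\<close> strictly drops from \<open>a\<close> to \<open>b\<close>.\<close>
    have "h (m j) - \<bar>m j - a\<bar> \<le> h a"
      unfolding h_def[of a]
    proof (rule cInf_greatest)
      show "C a \<noteq> {}" unfolding C_def using bouquet_path.jump[OF ab(3,1)] by blast
      fix c assume "c \<in> C a"
      then obtain l N where c: "c = l + \<epsilon> * real N" "bouquet_path D W t a l N"
        unfolding C_def by blast
      have "bouquet_path D W t (m j) (l + \<bar>m j - a\<bar>) N"
        using c(2) ab(2) midpoint_cell(1)[OF D, of j] unfolding m_def
        by (intro bouquet_path.within) auto
      from h_le[OF this] show "h (m j) - \<bar>m j - a\<bar> \<le> c" using c(1) by simp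
    qed
    moreover have "h b \<le> l' + \<epsilon> * real N'" by (rule h_le[OF ab(3)])
    ultimately show ?thesis using ab lN(2) by (intro exI[of _ a] exI[of _ b]) auto
  qed
  then obtain a b where ab: "(a j, b j) \<in> W" "\<lfloor>a j / D\<rfloor> = int j" "h (b j) < h (a j)" if "j \<in> J" for j
    by metis
  \<comment> \<open>\<open>g j\<close> is the wormhole in \<open>P\<close> behind the jump of arc
    \<open>j\<close>. If two arcs share it, they also share its orientation, because
    \<open>h\<close> drops from \<open>a\<close> to \<open>b\<close>; then they share
    \<open>a\<close>, and so the cell.\<close>
  define g where "g j = (if (a j, b j) \<in> P then (a j, b j) else (b j, a j))" for j
  have "inj_on g J"
  proof (rule inj_onI)
    fix i j assume ij: "i \<in> J" "j \<in> J" "g i = g j"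
    then have "(a i, b i) = (a j, b j) \<or> (a i, b i) = (b j, a j)"
      unfolding g_def by (auto split: if_splits)
    then have "a i = a j" using ab(3)[OF ij(1)] ab(3)[OF ij(2)] by (metis less_asym prod.inject)
    then show "i = j" using ab(2)[OF ij(1)] ab(2)[OF ij(2)] by (metis of_nat_eq_iff)
  qed
  moreover have "g ` J \<subseteq> P" using ab(1) unfolding g_def W_def by auto
  ultimately show ?thesis using \<open>finite P\<close> card_inj_on_le by blast
qed

lemma far_midpoints:
  assumes D: "D > 0" and "finite P" and "card P + 2 \<le> n"
  obtains i j where "i < n" and "j < n"
    and "\<And>l N. bouquet_path D (P \<union> P\<inverse>) ((real i + 1/2) * D) ((real j + 1/2) * D) l N \<Longrightarrow> D \<le> l"
proof -
  define W where "W = P \<union> P\<inverse>"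
  define m where "m j = (real j + 1/2) * D" for j :: nat
  have "sym W" unfolding W_def by (auto intro: symI)
  have g0: "grid_dist D 0 = 0" using grid_dist_multiple[OF D, of 0] by simp
  have "\<exists>i<n. \<forall>l N. bouquet_path D W 0 (m i) l N \<longrightarrow> D / 2 \<le> l"
  proof (rule ccontr)
    assume *: "\<not> ?thesis"
    \<comment> \<open>Here \<open>t = 0\<close> is itself a cut point, so \<open>K = 0\<close>, and
      every arc would need its own wormhole.\<close>
    have "card {..<n} \<le> card P"
    proof (rule card_arcs_le_wormholes[OF D, where t = 0 and K = 0])
      show "\<exists>l N. bouquet_path D (P \<union> P\<inverse>) 0 ((real j + 1/2) * D) l N \<and> l < 0 + D / 2"
        if "j \<in> {..<n}" for j
        using * that unfolding W_def m_def by (auto simp: not_le)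
      show "l \<ge> 0 - grid_dist D y" if "bouquet_path D (P \<union> P\<inverse>) 0 y l N" for y l N
        using bouquet_path_nonneg[OF that D] grid_dist_nonneg[OF D, of y] by linarith
    qed (use assms g0 in auto)
    then show False using assms(3) by simp
  qed
  then obtain i where i: "i < n" "\<And>l N. bouquet_path D W 0 (m i) l N \<Longrightarrow> D / 2 \<le> l" by blast
  have "\<exists>j<n. \<forall>l N. bouquet_path D W (m i) (m j) l N \<longrightarrow> D \<le> l"
  proof (rule ccontr)
    assume *: "\<not> ?thesis"
    \<comment> \<open>The choice of \<open>i\<close> allows \<open>K = D / 2\<close>. Arc
      \<open>i\<close> is left out because it contains the base point \<open>m i\<close>; the
      remaining \<open>n - 1\<close> arcs still outnumber the wormholes.\<close>
    have "card ({..<n} - {i}) \<le> card P"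
    proof (rule card_arcs_le_wormholes[OF D, where t = "m i" and K = "D / 2"])
      show "\<exists>l N. bouquet_path D (P \<union> P\<inverse>) (m i) ((real j + 1/2) * D) l N \<and> l < D / 2 + D / 2"
        if "j \<in> {..<n} - {i}" for j
        using * that unfolding W_def m_def by (auto simp: not_le)
      show "l \<ge> D / 2 - grid_dist D y" if "bouquet_path D (P \<union> P\<inverse>) (m i) y l N" for y l N
      proof -
        \<comment> \<open>Extending the path from \<open>y\<close> to the cut point costs
          \<open>grid_dist D y\<close>; the reversed path joins 0 to \<open>m i\<close>, so it has
          length at least \<open>D / 2\<close>.\<close>
        have "bouquet_path D W (m i) 0 (l + (grid_dist D 0 + grid_dist D y)) N"
          using that unfolding W_def by (rule bouquet_path.across)
        from i(2)[OF bouquet_path_sym[OF this \<open>sym W\<close>]] show ?thesis using g0 by simp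
      qed
      show "grid_dist D (m i) + D / 2 \<le> 0" if "j \<in> {..<n} - {i}" "\<lfloor>m i / D\<rfloor> = int j" for j
        using that midpoint_cell(1)[OF D, of i] unfolding m_def by simp
    qed (use assms in auto)
    then show False using assms(3) i(1) by simp
  qed
  then show ?thesis using that i(1) unfolding W_def m_def by blast
qed


section \<open>Points, classes and path lengths in a graph with wormholes\<close>

lemma edge_point_in_points:
  assumes "wf_graph G" and "x \<in> edges G" and "s \<in> {0..len G x}"
  shows "edge_point G x s \<in> points G"
  using assms unfolding edge_point_def points_def wf_graph_def by auto

lemma equiv_identified: "equiv (points G) (identified G ws)"
proof (rule equivI)
  show "identified G ws \<subseteq> points G \<times> points G" unfolding identified_def by blast
  show "refl_on (points G) (identified G ws)" unfolding identified_def by (auto intro: refl_onI)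
  have "sym ((set ws \<union> (set ws)\<inverse>)\<^sup>*)" by (intro sym_rtrancl) (auto intro: symI)
  then show "sym (identified G ws)" unfolding identified_def by (auto intro!: symI dest: symD)
  show "trans (identified G ws)" unfolding identified_def
    by (auto intro!: transI intro: rtrancl_trans)
qed

lemma wpoints_iff: "X \<in> wpoints G ws \<longleftrightarrow> (\<exists>p\<in>points G. X = identified G ws `` {p})"
  unfolding wpoints_def quotient_def by blast

lemma wormhole_class_eq:
  assumes "(p, q) \<in> set ws" and "p \<in> points G" and "q \<in> points G"
  shows "identified G ws `` {p} = identified G ws `` {q}"
  by (rule equiv_class_eq[OF equiv_identified]) (use assms in \<open>auto simp: identified_def\<close>)

lemma wpath_nonneg: "wpath G ws x y l \<Longrightarrow> l \<ge> 0"
  by (induction rule: wpath.induct) auto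

lemma wdist_le: "wpath G ws x y l \<Longrightarrow> wdist G ws x y \<le> l"
  unfolding wdist_def
  by (rule cInf_lower) (auto intro!: bdd_belowI[of _ 0] wpath_nonneg)

section \<open>Arc-length coordinates on a cycle\<close>

locale cycle_graph =
  fixes G :: "('v, 'e) weighted_graph" and n :: nat and v :: "nat \<Rightarrow> 'v" and e :: "nat \<Rightarrow> 'e"
  assumes wf: "wf_graph G" and n_pos: "n \<ge> 1"
    and verts: "bij_betw v {..<n} (verts G)" and edges: "bij_betw e {..<n} (edges G)"
    and ends: "\<And>i. i < n \<Longrightarrow> {tail G (e i), head G (e i)} = {v i, v (Suc i mod n)}"
begin

text \<open>Coordinate of the \<open>k\<close>-th vertex when the cycle is cut open at
  \<open>v 0\<close>; the index \<open>n\<close> stands for the return to \<open>v 0\<close> after a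
  full turn.\<close>

definition vertex_pos :: "nat \<Rightarrow> real" where
  "vertex_pos k = (\<Sum>i<k. len G (e i))"

abbreviation "circumference \<equiv> vertex_pos n"

text \<open>The cyclic order fixes only the unordered ends of an edge, so an edge may be
  parametrised against it; a single loop counts as forward.\<close>

definition forward :: "nat \<Rightarrow> bool" where
  "forward i \<longleftrightarrow> tail G (e i) = v i \<and> head G (e i) = v (Suc i mod n)"

definition arc_point :: "nat \<Rightarrow> real \<Rightarrow> ('v, 'e) point" where
  "arc_point i x =
     edge_point G (e i) (if forward i then x - vertex_pos i else vertex_pos (Suc i) - x)"

definition circle_point :: "real \<Rightarrow> ('v, 'e) point" where
  "circle_point x =
     arc_point (SOME i. i < n \<and> vertex_pos i \<le> x \<and> x \<le> vertex_pos (Suc i)) x"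

text \<open>Inverse of \<open>circle_point\<close> on \<open>[0, circumference)\<close>;
  \<open>v 0\<close> gets coordinate 0, never \<open>circumference\<close>.\<close>

definition pos :: "('v, 'e) point \<Rightarrow> real" where
  "pos p = (case p of
     Vertex y \<Rightarrow> vertex_pos (inv_into {..<n} v y)
   | Interior y t \<Rightarrow> (let i = inv_into {..<n} e y in
       if forward i then vertex_pos i + t else vertex_pos (Suc i) - t))"

lemma total_length_eq: "total_length G = circumference"
  unfolding total_length_def vertex_pos_def using sum.reindex_bij_betw[OF edges] by metis

lemma edge_in: "i < n \<Longrightarrow> e i \<in> edges G"
  using edges by (auto simp: bij_betw_def)

lemma len_pos: "i < n \<Longrightarrow> len G (e i) > 0"
  using wf edge_in unfolding wf_graph_def by blast

lemma vertex_pos_0 [simp]: "vertex_pos 0 = 0"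
  by (simp add: vertex_pos_def)

lemma vertex_pos_Suc: "vertex_pos (Suc i) = vertex_pos i + len G (e i)"
  by (simp add: vertex_pos_def)

lemma vertex_pos_mono: "i \<le> j \<Longrightarrow> j \<le> n \<Longrightarrow> vertex_pos i \<le> vertex_pos j"
  unfolding vertex_pos_def by (intro sum_mono2) (auto intro!: less_imp_le[OF len_pos])

lemma vertex_pos_strict_mono:
  assumes "i < j" and "j \<le> n"
  shows "vertex_pos i < vertex_pos j"
  using vertex_pos_mono[of "Suc i" j] len_pos[of i] assms by (simp add: vertex_pos_Suc)

lemma circumference_pos: "circumference > 0"
  using vertex_pos_strict_mono[of 0 n] n_pos by simp

lemma not_forward:
  assumes "i < n" and "\<not> forward i"
  shows "tail G (e i) = v (Suc i mod n)" and "head G (e i) = v i"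
  using ends[OF assms(1)] assms(2) unfolding forward_def by (auto simp: doubleton_eq_iff)

lemma arc_point_ends:
  assumes "i < n"
  shows "arc_point i (vertex_pos i) = Vertex (v i)"
    and "arc_point i (vertex_pos (Suc i)) = Vertex (v (Suc i mod n))"
  using len_pos[OF assms] not_forward[OF assms]
  by (auto simp: arc_point_def edge_point_def vertex_pos_Suc forward_def)

lemma pos_vertex: "i < n \<Longrightarrow> pos (Vertex (v i)) = vertex_pos i"
  using verts by (simp add: pos_def bij_betw_def)

lemma pos_arc_point:
  assumes i: "i < n" and x: "vertex_pos i \<le> x" "x \<le> vertex_pos (Suc i)"
  shows "pos (arc_point i x) = (if x = circumference then 0 else x)"
proof -
  have le: "vertex_pos (Suc i) \<le> circumference" using i by (intro vertex_pos_mono) auto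
  consider "x = vertex_pos i" | "x = vertex_pos (Suc i)"
    | "vertex_pos i < x" "x < vertex_pos (Suc i)"
    using x by linarith
  then show ?thesis
  proof cases
    case 1
    then show ?thesis using arc_point_ends(1)[OF i] pos_vertex[OF i] vertex_pos_strict_mono[of i n] i
      by simp
  next
    case 2
    show ?thesis
    \<comment> \<open>The last arc closes up at \<open>v 0\<close>, where the coordinate jumps back
      to 0.\<close>
    proof (cases "Suc i = n")
      case True
      then show ?thesis using 2 arc_point_ends(2)[OF i] pos_vertex[of 0] n_pos by simp
    next
      case False
      then have "Suc i < n" using i by simp
      then show ?thesis
        using 2 arc_point_ends(2)[OF i] pos_vertex[of "Suc i"] vertex_pos_strict_mono[of "Suc i" n]
        by simp
    qed
  next
    case 3
    then have "inv_into {..<n} e (e i) = i" using edges i by (simp add: bij_betw_def)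
    then show ?thesis using 3 le
      by (auto simp: arc_point_def edge_point_def pos_def vertex_pos_Suc)
  qed
qed

lemma ex_arc:
  assumes "0 \<le> x" and "x \<le> circumference"
  obtains i where "i < n" and "vertex_pos i \<le> x" and "x \<le> vertex_pos (Suc i)"
proof -
  have "\<exists>i<k. vertex_pos i \<le> x \<and> x \<le> vertex_pos (Suc i)"
    if "x \<le> vertex_pos k" "0 < k" for k
    using that
  proof (induction k)
    case (Suc k)
    show ?case
    proof (cases "x \<le> vertex_pos k \<and> 0 < k")
      case True
      then show ?thesis using Suc.IH less_SucI by blast
    next
      case False
      then have "vertex_pos k \<le> x" using assms(1) by auto
      then show ?thesis using Suc.prems(1) by blast
    qed
  qed simp
  from this[of n] show ?thesis using that assms(2) n_pos by auto
qed

text \<open>The choice made in \<open>circle_point\<close> is harmless: two different arcs whose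
  coordinate intervals share a value are consecutive and meet there in a common vertex.\<close>

lemma circle_point_eq:
  assumes "i < n" and "vertex_pos i \<le> x" and "x \<le> vertex_pos (Suc i)"
  shows "circle_point x = arc_point i x"
proof -
  have *: "arc_point i x = arc_point j x"
    if "i < j" "j < n" "x \<le> vertex_pos (Suc i)" "vertex_pos j \<le> x" for i j
  proof -
    have "vertex_pos (Suc i) \<le> vertex_pos j" using that by (intro vertex_pos_mono) auto
    then have x: "x = vertex_pos (Suc i)" "x = vertex_pos j" using that by auto
    then have "j = Suc i" using vertex_pos_strict_mono[of "Suc i" j] that by fastforce
    then show ?thesis using x arc_point_ends(2)[of i] arc_point_ends(1)[of j] that by simp
  qed
  define j where "j = (SOME i. i < n \<and> vertex_pos i \<le> x \<and> x \<le> vertex_pos (Suc i))"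
  have "j < n \<and> vertex_pos j \<le> x \<and> x \<le> vertex_pos (Suc j)"
    unfolding j_def by (rule someI[of _ i]) (use assms in auto)
  moreover have "circle_point x = arc_point j x" unfolding circle_point_def j_def ..
  ultimately show ?thesis using *[of i j] *[of j i] assms by (metis linorder_less_linear)
qed

lemma pos_circle_point:
  assumes "0 \<le> x" and "x \<le> circumference"
  shows "pos (circle_point x) = (if x = circumference then 0 else x)"
  by (rule ex_arc[OF assms]) (simp add: circle_point_eq pos_arc_point)

lemma circle_point_circumference: "circle_point circumference = circle_point 0"
proof -
  have "circle_point circumference = arc_point (n - 1) (vertex_pos (Suc (n - 1)))"
    using n_pos vertex_pos_mono[of "n - 1" n] by (subst circle_point_eq[of "n - 1"]) auto
  also have "\<dots> = Vertex (v 0)" using n_pos arc_point_ends(2)[of "n - 1"] by simp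
  also have "\<dots> = circle_point 0"
    using n_pos circle_point_eq[of 0 0] arc_point_ends(1)[of 0] len_pos[of 0]
    by (simp add: vertex_pos_Suc)
  finally show ?thesis .
qed

text \<open>On each edge the coordinate is a translation or a reflection, so moves keep their
  length. Both ends of the closed interval are allowed, as the closing edge has to end at
  \<open>circumference\<close> rather than at 0.\<close>

lemma edge_point_circle_points:
  assumes "x \<in> edges G" and "s \<in> {0..len G x}" and "t \<in> {0..len G x}"
  obtains a b where "a \<in> {0..circumference}" and "b \<in> {0..circumference}" and "\<bar>a - b\<bar> = \<bar>s - t\<bar>"
    and "edge_point G x s = circle_point a" and "edge_point G x t = circle_point b"
proof -
  obtain i where i: "i < n" "x = e i" using assms(1) edges by (auto simp: bij_betw_def)
  define f where "f s = (if forward i then vertex_pos i + s else vertex_pos (Suc i) - s)" for s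
  have f: "vertex_pos i \<le> f s" "f s \<le> vertex_pos (Suc i)" "edge_point G x s = circle_point (f s)"
    if "s \<in> {0..len G x}" for s
  proof -
    show "vertex_pos i \<le> f s" "f s \<le> vertex_pos (Suc i)"
      using that i(2) by (auto simp: f_def vertex_pos_Suc)
    then have "circle_point (f s) = arc_point i (f s)" using i(1) by (rule circle_point_eq[rotated])
    also have "\<dots> = edge_point G x s" using i(2) by (simp add: arc_point_def f_def)
    finally show "edge_point G x s = circle_point (f s)" ..
  qed
  have "0 \<le> vertex_pos i" "vertex_pos (Suc i) \<le> circumference"
    using vertex_pos_mono[of 0 i] vertex_pos_mono[of "Suc i" n] i(1) by auto
  moreover have "\<bar>f s - f t\<bar> = \<bar>s - t\<bar>" by (auto simp: f_def)
  ultimately show ?thesis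
    using that[of "f s" "f t"] f[OF assms(2)] f[OF assms(3)] by auto
qed

lemma circle_point_in_points:
  assumes "x \<in> {0..circumference}"
  shows "circle_point x \<in> points G"
proof -
  obtain i where i: "i < n" "vertex_pos i \<le> x" "x \<le> vertex_pos (Suc i)"
    using ex_arc assms by auto
  then have "circle_point x = arc_point i x" by (rule circle_point_eq)
  also have "\<dots> \<in> points G" unfolding arc_point_def
    using i by (intro edge_point_in_points[OF wf edge_in]) (auto simp: vertex_pos_Suc)
  finally show ?thesis .
qed

lemma points_eq: "points G = circle_point ` {0..<circumference}"
proof -
  have "p \<in> circle_point ` {0..circumference}" if "p \<in> points G" for p
  proof -
    have "\<exists>x\<in>edges G. \<exists>s\<in>{0..len G x}. p = edge_point G x s"
    proof (cases p)
      case (Vertex y)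
      then obtain i where i: "i < n" "y = v i"
        using \<open>p \<in> points G\<close> verts by (auto simp: points_def bij_betw_def)
      have "v i \<in> {tail G (e i), head G (e i)}" using ends[OF i(1)] by simp
      then have "p = edge_point G (e i) 0 \<or> p = edge_point G (e i) (len G (e i))"
        using Vertex i len_pos[OF i(1)] by (auto simp: edge_point_def)
      moreover have "0 \<in> {0..len G (e i)}" "len G (e i) \<in> {0..len G (e i)}"
        using len_pos[OF i(1)] by auto
      ultimately show ?thesis using edge_in[OF i(1)] by metis
    next
      case (Interior y t)
      then have "y \<in> edges G" "0 < t" "t < len G y" "p = edge_point G y t"
        using \<open>p \<in> points G\<close> by (auto simp: points_def edge_point_def)
      then show ?thesis by (intro bexI[of _ y] bexI[of _ t]) auto
    qed
    then obtain x s where "x \<in> edges G" "s \<in> {0..len G x}" "p = edge_point G x s" by blast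
    then show ?thesis using edge_point_circle_points[of x s s] by blast
  qed
  moreover have "circle_point ` {0..circumference} \<subseteq> circle_point ` {0..<circumference}"
  proof
    fix p assume "p \<in> circle_point ` {0..circumference}"
    then obtain x where x: "0 \<le> x" "x \<le> circumference" "p = circle_point x" by auto
    show "p \<in> circle_point ` {0..<circumference}"
    proof (cases "x = circumference")
      case True
      then show ?thesis using x circle_point_circumference circumference_pos by auto
    qed (use x in auto)
  qed
  ultimately show ?thesis using circle_point_in_points by auto
qed

section \<open>Paths along the circle and boundedness of distances\<close>

text \<open>A single move stays on one edge, so a longer segment is split at the vertices it passes.
  The induction adds one arc at a time, and lengths add up because the split vertex lies between the
  endpoints.\<close>

lemma wpath_along:
  assumes "wpath G ws X (identified G ws `` {circle_point a}) l"
    and "a \<in> {0..circumference}" and "b \<in> {0..circumference}"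
  shows "wpath G ws X (identified G ws `` {circle_point b}) (l + \<bar>a - b\<bar>)"
proof -
  define joined where "joined a b \<longleftrightarrow> (\<forall>l. wpath G ws X (identified G ws `` {circle_point a}) l \<longrightarrow>
    wpath G ws X (identified G ws `` {circle_point b}) (l + \<bar>a - b\<bar>))" for a b
  have joined_trans: "joined a c" if "joined a b" "joined b c" "a \<le> b \<and> b \<le> c \<or> c \<le> b \<and> b \<le> a"
    for a b c
  proof -
    have "l + \<bar>a - b\<bar> + \<bar>b - c\<bar> = l + \<bar>a - c\<bar>" for l using that(3) by auto
    then show ?thesis using that(1,2) unfolding joined_def by metis
  qed
  have arc: "joined a b" if i: "i < n" and
    ab: "a \<in> {vertex_pos i..vertex_pos (Suc i)}" "b \<in> {vertex_pos i..vertex_pos (Suc i)}" for i a b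
    unfolding joined_def
  proof (intro allI impI)
    fix l assume path: "wpath G ws X (identified G ws `` {circle_point a}) l"
    define f where "f x = (if forward i then x - vertex_pos i else vertex_pos (Suc i) - x)" for x
    have eq: "circle_point a = edge_point G (e i) (f a)" "circle_point b = edge_point G (e i) (f b)"
      using circle_point_eq[OF i] ab by (auto simp: arc_point_def f_def)
    have "wpath G ws X (identified G ws `` {edge_point G (e i) (f b)}) (l + \<bar>f a - f b\<bar>)"
      using ab by (intro wpath.move[OF path[unfolded eq(1)] edge_in[OF i]])
        (auto simp: f_def vertex_pos_Suc)
    moreover have "\<bar>f a - f b\<bar> = \<bar>a - b\<bar>" by (auto simp: f_def)
    ultimately show "wpath G ws X (identified G ws `` {circle_point b}) (l + \<bar>a - b\<bar>)"
      by (simp add: eq(2))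
  qed
  have "joined a b" if "k \<le> n" "a \<in> {0..vertex_pos k}" "b \<in> {0..vertex_pos k}" for k a b
    using that
  proof (induction k arbitrary: a b)
    case 0
    then show ?case by (auto simp: joined_def)
  next
    case (Suc k)
    let ?m = "vertex_pos k"
    have k: "k < n" "0 \<le> ?m" "?m \<le> vertex_pos (Suc k)"
      using Suc.prems(1) vertex_pos_mono[of 0 k] vertex_pos_mono[of k "Suc k"] by auto
    have low: "joined a b" if "a \<in> {0..?m}" "b \<in> {0..?m}" for a b
      using Suc.IH that k by simp
    consider "a \<le> ?m" "b \<le> ?m" | "?m \<le> a" "?m \<le> b" | "a \<le> ?m" "?m \<le> b" | "?m \<le> a" "b \<le> ?m"
      by linarith
    then show ?case
    proof cases
      case 1
      then show ?thesis using low Suc.prems by auto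
    next
      case 2
      then show ?thesis using arc[OF k(1)] Suc.prems by auto
    next
      case 3
      then show ?thesis
        using joined_trans[OF low arc[OF k(1)], of a ?m b] Suc.prems k by auto
    next
      case 4
      then show ?thesis
        using joined_trans[OF arc[OF k(1)] low, of a ?m b] Suc.prems k by auto
    qed
  qed
  then show ?thesis using assms unfolding joined_def by blast
qed

lemma wpath_refl:
  "p \<in> points G \<Longrightarrow> wpath G ws (identified G ws `` {p}) (identified G ws `` {p}) 0"
  by (intro wpath.stay) (auto simp: wpoints_iff)

lemma wpath_circle_points:
  assumes "a \<in> {0..circumference}" and "b \<in> {0..circumference}"
  shows "wpath G ws (identified G ws `` {circle_point a}) (identified G ws `` {circle_point b}) \<bar>a - b\<bar>"
  using wpath_along[OF wpath_refl[OF circle_point_in_points]] assms by fastforce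

lemma wpointsE:
  assumes "X \<in> wpoints G ws"
  obtains a where "0 \<le> a" and "a < circumference" and "X = identified G ws `` {circle_point a}"
  using assms points_eq unfolding wpoints_iff by auto

lemma wdist_le_wdiam:
  assumes "X \<in> wpoints G ws" and "Y \<in> wpoints G ws"
  shows "wdist G ws X Y \<le> wdiam G ws"
  unfolding wdiam_def
proof (rule cSup_upper)
  \<comment> \<open>\<open>Sup\<close> bounds its elements only for a set bounded above; walking
    along the circle gives the bound.\<close>
  have "wdist G ws X Y \<le> circumference" if "X \<in> wpoints G ws" "Y \<in> wpoints G ws" for X Y
  proof -
    obtain a b where ab: "0 \<le> a" "a < circumference" "X = identified G ws `` {circle_point a}"
      "0 \<le> b" "b < circumference" "Y = identified G ws `` {circle_point b}"
      using \<open>X \<in> _\<close> \<open>Y \<in> _\<close> wpointsE by metis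
    then have "wdist G ws X Y \<le> \<bar>a - b\<bar>" by (auto intro!: wdist_le wpath_circle_points)
    then show ?thesis using ab by linarith
  qed
  then show "bdd_above {wdist G ws x y |x y. x \<in> wpoints G ws \<and> y \<in> wpoints G ws}"
    by (intro bdd_aboveI[of _ circumference]) blast
qed (use assms in blast)

section \<open>Projection to the bouquet and the lower bound\<close>

definition wormhole_positions :: "('v, 'e) wormhole list \<Rightarrow> (real \<times> real) set" where
  "wormhole_positions ws = map_prod pos pos ` set ws"

text \<open>A chain of identifications becomes a chain of jumps, each of length zero.\<close>

lemma bouquet_path_jumps:
  assumes "bouquet_path D (wormhole_positions ws \<union> (wormhole_positions ws)\<inverse>) t (pos p) l N"
    and "(p, q) \<in> (set ws \<union> (set ws)\<inverse>)\<^sup>*"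
  shows "\<exists>N. bouquet_path D (wormhole_positions ws \<union> (wormhole_positions ws)\<inverse>) t (pos q) l N"
  using assms(2)
proof (induction rule: rtrancl_induct)
  case base
  show ?case using assms(1) by blast
next
  case (step q r)
  then have "(pos r, pos q) \<in> wormhole_positions ws \<union> (wormhole_positions ws)\<inverse>"
    by (force simp: wormhole_positions_def)
  then show ?case using step.IH bouquet_path.jump by blast
qed

text \<open>
  A move that reaches \<open>circumference\<close> lands at position 0; since \<open>circumference\<close> is a multiple
  of \<open>D\<close>, both positions are glued together in the bouquet.
\<close>

lemma bouquet_path_of_wpath:
  assumes "wpath G ws (identified G ws `` {circle_point t}) Y l"
    and D: "D > 0" and k: "circumference = real k * D"
    and t: "0 \<le> t" "t < circumference" and "q \<in> Y"
  shows "\<exists>l' N. l' \<le> l \<and>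
    bouquet_path D (wormhole_positions ws \<union> (wormhole_positions ws)\<inverse>) t (pos q) l' N"
  using assms(1,6)
proof (induction "identified G ws `` {circle_point t}" Y l arbitrary: q rule: wpath.induct)
  case stay
  then have "(circle_point t, q) \<in> (set ws \<union> (set ws)\<inverse>)\<^sup>*" by (auto simp: identified_def)
  moreover have "pos (circle_point t) = t" using pos_circle_point t by simp
  ultimately show ?case using bouquet_path_jumps bouquet_path.start by (metis order_refl)
next
  case (move x s l u)
  let ?W = "wormhole_positions ws \<union> (wormhole_positions ws)\<inverse>"
  have "edge_point G x s \<in> identified G ws `` {edge_point G x s}"
    using edge_point_in_points[OF wf] move by (auto simp: identified_def)
  then obtain l' N where l': "l' \<le> l" "bouquet_path D ?W t (pos (edge_point G x s)) l' N"
    using move(2) by blast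
  obtain a b where ab: "a \<in> {0..circumference}" "b \<in> {0..circumference}" "\<bar>a - b\<bar> = \<bar>s - u\<bar>"
    "edge_point G x s = circle_point a" "edge_point G x u = circle_point b"
    using edge_point_circle_points move by metis
  define r where "r x = (if x = circumference then 0 else x)" for x
  have r: "pos (circle_point x) = r x" if "x \<in> {0..circumference}" for x
    using that pos_circle_point unfolding r_def by auto
  have "\<exists>d N. d \<le> \<bar>a - b\<bar> \<and> bouquet_path D ?W t (r b) (l' + d) N"
  \<comment> \<open>Either the move stays in one cell without wrapping at
    \<open>circumference\<close>, or it is trivial, or it really passes a cut point and is replaced
    by \<open>across\<close>.\<close>
  proof (cases "r a = a \<and> r b = b \<and> \<lfloor>a / D\<rfloor> = \<lfloor>b / D\<rfloor> \<or> a = b")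
    case True
    then have "\<lfloor>r b / D\<rfloor> = \<lfloor>r a / D\<rfloor>" "\<bar>r b - r a\<bar> \<le> \<bar>a - b\<bar>" by auto
    then show ?thesis using bouquet_path.within l'(2) ab(1,4) r by metis
  next
    case False
    have grid: "grid_dist D (r x) = grid_dist D x" for x
      using grid_dist_multiple[OF D, of 0] grid_dist_multiple[OF D, of k] by (simp add: r_def k)
    have "\<lfloor>a / D\<rfloor> \<noteq> \<lfloor>b / D\<rfloor>"
    proof
      assume eq: "\<lfloor>a / D\<rfloor> = \<lfloor>b / D\<rfloor>"
      \<comment> \<open>As \<open>circumference\<close> is a multiple of \<open>D\<close>, it is the
        lowest point of its cell, hence the only point of the interval in that cell. So a wrapping
        move within one cell would be trivial.\<close>
      have top: "x = circumference" if "x \<in> {0..circumference}" "\<lfloor>x / D\<rfloor> = \<lfloor>circumference / D\<rfloor>" for x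
      proof -
        have "int k \<le> \<lfloor>x / D\<rfloor>" using that(2) D by (simp add: k)
        then have "real k * D \<le> x" using D by (simp add: le_floor_iff pos_le_divide_eq)
        then show ?thesis using that(1) k by simp
      qed
      show False using False eq top[OF ab(1)] top[OF ab(2)] by (auto simp: r_def split: if_splits)
    qed
    then have "grid_dist D (r b) + grid_dist D (r a) \<le> \<bar>a - b\<bar>"
      unfolding grid using grid_dist_different_cells[OF D, of a b] by linarith
    then show ?thesis using bouquet_path.across l'(2) ab(1,4) r by metis
  qed
  then obtain d N where d: "d \<le> \<bar>a - b\<bar>" "bouquet_path D ?W t (pos (edge_point G x u)) (l' + d) N"
    using ab r by metis
  have "(edge_point G x u, q) \<in> (set ws \<union> (set ws)\<inverse>)\<^sup>*"
    using move.prems by (auto simp: identified_def)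
  from bouquet_path_jumps[OF d(2) this] show ?case using d(1) ab(3) l'(1) by (metis add_mono)
qed

lemma wdiam_lower_bound: "circumference / (real (length ws) + 2) \<le> wdiam G ws"
proof -
  define D where "D = circumference / (real (length ws) + 2)"
  have D: "D > 0" unfolding D_def using circumference_pos by simp
  have k: "circumference = real (length ws + 2) * D" unfolding D_def by (simp add: field_simps)
  let ?P = "wormhole_positions ws"
  \<comment> \<open>Repeated wormholes, or ones with the same positions, only lower the
    count.\<close>
  have "card ?P \<le> length ws"
    unfolding wormhole_positions_def by (metis List.finite_set card_image_le card_length le_trans)
  moreover have "finite ?P" by (simp add: wormhole_positions_def)
  ultimately obtain i j where ij: "i < length ws + 2" "j < length ws + 2"
    "\<And>l N. bouquet_path D (?P \<union> ?P\<inverse>) ((real i + 1/2) * D) ((real j + 1/2) * D) l N \<Longrightarrow> D \<le> l"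
    using far_midpoints[OF D, of ?P "length ws + 2"] by auto
  define m where "m i = (real i + 1/2) * D" for i :: nat
  have m: "0 \<le> m i" "m i < circumference" if "i < length ws + 2" for i
  proof -
    show "0 \<le> m i" using D by (simp add: m_def)
    have "real i + 1/2 < real (length ws + 2)" using that by linarith
    then show "m i < circumference" unfolding m_def k using D by (rule mult_strict_right_mono)
  qed
  let ?X = "identified G ws `` {circle_point (m i)}" and ?Y = "identified G ws `` {circle_point (m j)}"
  have mem: "circle_point (m i) \<in> points G" "circle_point (m j) \<in> points G"
    using m ij by (auto intro!: circle_point_in_points less_imp_le)
  have "D \<le> wdist G ws ?X ?Y"
    unfolding wdist_def
  proof (rule cInf_greatest)
    show "{l. wpath G ws ?X ?Y l} \<noteq> {}"
      using wpath_circle_points[of "m i" "m j" ws] m[OF ij(1)] m[OF ij(2)] by auto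
    fix l assume "l \<in> {l. wpath G ws ?X ?Y l}"
    then have "wpath G ws ?X ?Y l" by simp
    from bouquet_path_of_wpath[OF this D k m[OF ij(1)] equiv_class_self[OF equiv_identified mem(2)]]
    have "\<exists>l' N. l' \<le> l \<and>
      bouquet_path D (?P \<union> ?P\<inverse>) (m i) (pos (circle_point (m j))) l' N" .
    moreover have "pos (circle_point (m j)) = m j" using pos_circle_point m[OF ij(2)] by simp
    ultimately show "D \<le> l" using ij(3) unfolding m_def by force
  qed
  also have "\<dots> \<le> wdiam G ws" by (rule wdist_le_wdiam) (use mem in \<open>auto simp: wpoints_iff\<close>)
  finally show ?thesis unfolding D_def .
qed

section \<open>Optimal wormholes for even \<open>w\<close>\<close>

lemma ex_wormholes_attaining:
  assumes "even w"
  shows "\<exists>ws. set ws \<subseteq> points G \<times> points G \<and> length ws = w \<and>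
    wdiam G ws \<le> circumference / (real w + 2)"
proof -
  obtain k where w: "w = 2 * k" using assms by blast
  define D where "D = circumference / (real w + 2)"
  have D: "D > 0" unfolding D_def using circumference_pos by simp
  have circ: "circumference = real (2 * k + 2) * D" unfolding D_def w by (simp add: field_simps)
  define c where "c j = circle_point (real j * D)" for j :: nat
  \<comment> \<open>The cut points \<open>c 2\<close>, ..., \<open>c (w + 1)\<close> are each glued
    to \<open>c 0\<close> or \<open>c 1\<close> according to parity, which takes exactly
    \<open>w\<close> wormholes.\<close>
  define ws where "ws = map (\<lambda>j. (c (j mod 2), c (j + 2))) [0..<w]"
  have range: "real j * D \<in> {0..circumference}" if "j \<le> 2 * k + 2" for j
    using that D unfolding circ by (intro atLeastAtMost_iff[THEN iffD2] conjI mult_right_mono) auto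
  have c_in: "c j \<in> points G" if "j \<le> 2 * k + 2" for j
    unfolding c_def by (rule circle_point_in_points[OF range[OF that]])
  have ws: "set ws \<subseteq> points G \<times> points G" "length ws = w"
    unfolding ws_def w by (auto intro!: c_in)
  define E where "E j = identified G ws `` {c j}" for j
  have E: "E j = E (j mod 2)" if "j \<le> 2 * k + 2" for j
  proof -
    have "j < 2 \<or> (j = j - 2 + 2 \<and> j - 2 < w) \<or> j = 2 * k + 2" using that w by linarith
    then consider "j < 2" | i where "j = i + 2" "i < w" | "j = 2 * k + 2" by blast
    then show ?thesis
    proof cases
      case 2
      have "(c (i mod 2), c (i + 2)) \<in> set ws" unfolding ws_def using 2 by auto
      then have "E (i mod 2) = E (i + 2)"
        unfolding E_def using ws(1) by (intro wormhole_class_eq) auto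
      then show ?thesis using 2 by simp
    next
      case 3
      \<comment> \<open>The last index needs no wormhole: it is \<open>c 0\<close> again after a
        full turn, and its parity fits because \<open>w\<close> is even.\<close>
      then have "c j = c 0" unfolding c_def using circle_point_circumference circ by simp
      then show ?thesis using 3 by (simp add: E_def)
    qed simp
  qed
  \<comment> \<open>Every point lies on an arc of length \<open>D\<close> whose ends belong to
    \<open>E 0\<close> and \<open>E 1\<close>. The parity of the arc's index \<open>j\<close>
    decides which end is which.\<close>
  have near: "\<exists>\<alpha>.
    (\<exists>x\<in>{0..circumference}. E 0 = identified G ws `` {circle_point x} \<and> \<bar>a - x\<bar> = \<alpha>) \<and>
    (\<exists>x\<in>{0..circumference}. E 1 = identified G ws `` {circle_point x} \<and> \<bar>a - x\<bar> = D - \<alpha>)"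
    if a: "0 \<le> a" "a < circumference" for a
  proof -
    define j where "j = nat \<lfloor>a / D\<rfloor>"
    have fl: "0 \<le> \<lfloor>a / D\<rfloor>" using a D by simp
    then have "real j \<le> a / D" "a / D < real j + 1" unfolding j_def by (simp_all add: floor_less_iff)
    then have j: "real j * D \<le> a" "a < real (Suc j) * D" using D by (simp_all add: field_simps)
    have "real j * D < real (2 * k + 2) * D" using j(1) a(2) circ by linarith
    then have jk: "j \<le> 2 * k + 2" "Suc j \<le> 2 * k + 2" using D by (simp_all add: mult_less_cancel_right)
    have d: "\<bar>a - real j * D\<bar> = a - real j * D" "\<bar>a - real (Suc j) * D\<bar> = D - (a - real j * D)"
      using j by (auto simp: algebra_simps)
    have Ej: "E (j mod 2) = identified G ws `` {circle_point (real j * D)}"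
      "E (Suc j mod 2) = identified G ws `` {circle_point (real (Suc j) * D)}"
      using E[OF jk(1)] E[OF jk(2)] unfolding E_def c_def by auto
    show ?thesis
    proof (cases "even j")
      case True
      then have "j mod 2 = 0" "Suc j mod 2 = 1" by presburger+
      then show ?thesis using Ej d range[OF jk(1)] range[OF jk(2)]
        by (intro exI[of _ "a - real j * D"]) (auto intro!: bexI)
    next
      case False
      then have "j mod 2 = 1" "Suc j mod 2 = 0" by presburger+
      then show ?thesis using Ej d range[OF jk(1)] range[OF jk(2)]
        by (intro exI[of _ "D - (a - real j * D)"]) (auto intro!: bexI)
    qed
  qed
  have "wdist G ws X Y \<le> D" if XY: "X \<in> wpoints G ws" "Y \<in> wpoints G ws" for X Y
  proof -
    obtain a b where ab: "0 \<le> a" "a < circumference" "X = identified G ws `` {circle_point a}"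
      "0 \<le> b" "b < circumference" "Y = identified G ws `` {circle_point b}"
      using XY wpointsE by metis
    have via: "wdist G ws X Y \<le> \<bar>a - x\<bar> + \<bar>b - y\<bar>"
      if "x \<in> {0..circumference}" "y \<in> {0..circumference}"
        "identified G ws `` {circle_point x} = identified G ws `` {circle_point y}" for x y
    proof -
      have "wpath G ws X (identified G ws `` {circle_point y}) \<bar>a - x\<bar>"
        using wpath_circle_points[of a x ws] ab that by simp
      from wpath_along[OF this that(2)] have "wpath G ws X Y (\<bar>a - x\<bar> + \<bar>y - b\<bar>)" using ab by simp
      from wdist_le[OF this] show ?thesis by (simp add: abs_minus_commute)
    qed
    obtain \<alpha> x0 x1 where A: "x0 \<in> {0..circumference}" "E 0 = identified G ws `` {circle_point x0}"
      "\<bar>a - x0\<bar> = \<alpha>" "x1 \<in> {0..circumference}" "E 1 = identified G ws `` {circle_point x1}"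
      "\<bar>a - x1\<bar> = D - \<alpha>"
      using near[OF ab(1,2)] by blast
    obtain \<beta> y0 y1 where B: "y0 \<in> {0..circumference}" "E 0 = identified G ws `` {circle_point y0}"
      "\<bar>b - y0\<bar> = \<beta>" "y1 \<in> {0..circumference}" "E 1 = identified G ws `` {circle_point y1}"
      "\<bar>b - y1\<bar> = D - \<beta>"
      using near[OF ab(4,5)] by blast
    \<comment> \<open>The routes through \<open>E 0\<close> and \<open>E 1\<close> have lengths
      \<alpha> + \<beta> and \<open>2 * D\<close> - \<alpha> - \<beta>; they sum to
      \<open>2 * D\<close>, so one of them is at most \<open>D\<close>.\<close>
    show ?thesis using via[of x0 y0] via[of x1 y1] A B by simp
  qed
  moreover have "wpoints G ws \<noteq> {}" using c_in[of 0] wpoints_iff by blast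
  ultimately have "wdiam G ws \<le> D" unfolding wdiam_def by (intro cSup_least) blast+
  then show ?thesis using ws unfolding D_def by blast
qed

end

theorem mainTheorem7:
  fixes G :: "('v, 'e) weighted_graph" and L :: real and w :: nat
  assumes "is_cycle G" and "total_length G = L" and "L > 0"
  shows "(\<forall>ws. set ws \<subseteq> points G \<times> points G \<and> length ws = w \<longrightarrow>
             wdiam G ws \<ge> L / (real w + 2)) \<and>
         (even w \<longrightarrow>
           (\<exists>ws. set ws \<subseteq> points G \<times> points G \<and> length ws = w \<and>
             wdiam G ws = L / (real w + 2)))"
proof -
  obtain n v e where "cycle_graph G n v e"
    using assms(1) unfolding is_cycle_def cycle_graph_def by blast
  then interpret cycle_graph G n v e .
  have L: "circumference = L" using assms(2) total_length_eq by simp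
  show ?thesis
    using wdiam_lower_bound ex_wormholes_attaining unfolding L by (metis antisym)
qed

end
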